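(* Let $m\ge 1$ be an integer, let $p_1,\dots,p_m>0$ with $\sum_{i=1}^m p_i=1$, and let $Y_1,Y_2,\dots$ be a sequence of i.i.d. random variables with $P(Y_j=i)=p_i$ for all $i\in[m]$ and $j\ge 1$. For $n\ge 1$ let $\mathcal N_n$ be the empirical nerve of $(Y_1,\dots,Y_n)$, and let $X=\inf\{n\in\mathbb N:\mathcal N_n=\Delta_{m-1}\}$ be the waiting time until the empirical nerve is the $(m-1)$-simplex. Then $$\mathbb E X\ \le\ 2\int_0^\infty\left(1-\prod_{i=1}^m\left(1-e^{-p_i x}\right)\right)dx.$$ Moreover, in the uniform case where $p_i=\frac1m$ for all $i\in[m]$, $$\mathbb E X\ \le\ 2m\sum_{i=1}^m\frac1i.$$
   Context: Notation: $[N]=\{1,\dots,N\}$. For each $n$ and each label $i\in[m]$, the empirical support is $I_n(i)=\mathrm{Conv}(\{j\in[n]:Y_j=i\})\subset\mathbb R$, i.e. the closed interval from the first to the last index in $[n]$ at which label $i$ occurs (possibly a single point; empty if label $i$ does not occur among $Y_1,\dots,Y_n$). The empirical nerve $\mathcal N_n$ is the abstract simplicial complex whose simplices are the nonempty subsets $J\subseteq[m]$ with $\bigcap_{i\in J}I_n(i)\ne\emptyset$. $\Delta_{m-1}$ is the full simplex on vertex set $[m]$, i.e. $\mathcal N_n=\Delta_{m-1}$ means $\bigcap_{i=1}^m I_n(i)\neq\emptyset$. *)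

theory Defs
  imports "HOL-Probability.Probability"
begin

text \<open>Labels are the naturals in \<open>{1..m}\<close>. A label sequence \<open>y\<close> is read at the indices
  \<open>1, 2, \<dots>\<close> only; the value \<open>y 0\<close> is never used.\<close>

definition empirical_support :: "(nat \<Rightarrow> nat) \<Rightarrow> nat \<Rightarrow> nat \<Rightarrow> real set" where
  "empirical_support y n i = convex hull (real ` {j \<in> {1..n}. y j = i})"

text \<open>Abstract simplicial complexes are given by their sets of (nonempty) simplices.\<close>

definition empirical_nerve :: "nat \<Rightarrow> (nat \<Rightarrow> nat) \<Rightarrow> nat \<Rightarrow> nat set set" where
  "empirical_nerve m y n =
     {J. J \<subseteq> {1..m} \<and> J \<noteq> {} \<and> (\<Inter>i\<in>J. empirical_support y n i) \<noteq> {}}"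

definition full_simplex :: "nat \<Rightarrow> nat set set" where
  "full_simplex m = {J. J \<subseteq> {1..m} \<and> J \<noteq> {}}"

text \<open>The infimum is taken in \<^typ>\<open>enat\<close>, so it is \<open>\<infinity>\<close> if the nerve is never the full simplex.\<close>

definition nerve_waiting_time :: "nat \<Rightarrow> (nat \<Rightarrow> nat) \<Rightarrow> enat" where
  "nerve_waiting_time m y = Inf (enat ` {n. n \<ge> 1 \<and> empirical_nerve m y n = full_simplex m})"

lemma empirical_nerve_eq_full_simplex_iff:
  assumes "m \<ge> 1"
  shows "empirical_nerve m y n = full_simplex m \<longleftrightarrow> (\<Inter>i\<in>{1..m}. empirical_support y n i) \<noteq> {}"
proof
  assume "empirical_nerve m y n = full_simplex m"
  moreover have "{1..m} \<in> full_simplex m"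
    using assms by (simp add: full_simplex_def)
  ultimately have "{1..m} \<in> empirical_nerve m y n"
    by simp
  then show "(\<Inter>i\<in>{1..m}. empirical_support y n i) \<noteq> {}"
    by (simp add: empirical_nerve_def)
next
  assume "(\<Inter>i\<in>{1..m}. empirical_support y n i) \<noteq> {}"
  then show "empirical_nerve m y n = full_simplex m"
    unfolding empirical_nerve_def full_simplex_def by blast
qed

end

theory Submission
  imports Defs
begin

text \<open>Once every label has occurred among the indices \<open>1, \<dots>, k\<close> and again among
  \<open>k + 1, \<dots>, n\<close>, the point \<open>k\<close> lies in all the supports. So the waiting time is at most the sum
  of two consecutive coupon collector times, which are independent with the same mean.
  By inclusion-exclusion, both that mean and the integral equal
  \<open>\<Sum> (-1)\<^bsup>\<bar>I\<bar> + 1\<^esup> / p(I)\<close> over the nonempty sets \<open>I\<close> of labels, where \<open>p(I) = \<Sum>i\<in>I. p i\<close>.\<close>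

section \<open>Deterministic bound on the waiting time, and tail sums\<close>

lemma nerve_waiting_time_le:
  assumes "m \<ge> 1" and before: "{1..m} \<subseteq> y ` {0<..k}" and after: "{1..m} \<subseteq> y ` {k<..n}"
  shows "nerve_waiting_time m y \<le> enat n"
proof -
  have "real k \<in> empirical_support y n i" if i: "i \<in> {1..m}" for i
  proof -
    have "i \<in> y ` {0<..k}" "i \<in> y ` {k<..n}"
      using i before after by blast+
    then obtain a b where a: "0 < a" "a \<le> k" "y a = i" and b: "k < b" "b \<le> n" "y b = i"
      by auto
    have "closed_segment (real a) (real b) \<subseteq> empirical_support y n i"
      unfolding empirical_support_def segment_convex_hull
      using a b by (intro hull_mono) auto
    then show ?thesis
      using a b by (auto simp: closed_segment_eq_real_ivl)
  qed
  then have "empirical_nerve m y n = full_simplex m"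
    using empirical_nerve_eq_full_simplex_iff[OF \<open>m \<ge> 1\<close>] by blast
  \<comment> \<open>The infimum ranges over positive \<open>n\<close> only. Label 1 must occur in
    \<open>{k<..n}\<close>, so this block is nonempty.\<close>
  moreover have "n \<ge> 1"
  proof -
    have "1 \<in> y ` {k<..n}"
      using after \<open>m \<ge> 1\<close> by auto
    then show ?thesis
      by auto
  qed
  ultimately show ?thesis
    unfolding nerve_waiting_time_def by (intro Inf_lower) auto
qed

text \<open>Tail-sum formula: \<open>N\<close> counts the naturals below it, starting from 0. For
  \<open>N = \<infinity>\<close> every term of the counting series is 1 and the partial sums tend to
  \<open>top\<close>. It is applied pointwise, to reduce an expected waiting time to a sum of
  probabilities.\<close>

lemma ennreal_of_enat_le_suminf:
  assumes "\<And>n. enat n < N \<Longrightarrow> f n \<ge> (1 :: ennreal)"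
  shows "ennreal_of_enat N \<le> (\<Sum>n. f n)"
proof -
  have "(\<lambda>n::nat. if enat n < N then 1 else 0) sums ennreal_of_enat N"
    using sums_If_finite[of "\<lambda>n. enat n < N" "\<lambda>_. 1 :: ennreal"]
    by (cases N) (simp_all add: sums_def of_nat_tendsto_top_ennreal)
  then have "ennreal_of_enat N = (\<Sum>n::nat. if enat n < N then 1 else 0)"
    by (simp add: sums_iff)
  also have "\<dots> \<le> (\<Sum>n. f n)"
    using assms by (intro suminf_le) auto
  finally show ?thesis .
qed

section \<open>Inclusion-exclusion and the two integrals\<close>

text \<open>Expanding the product gives one signed term per subset of \<open>A\<close>. The empty
  subset contributes 1, which cancels, and the remaining signs flip.\<close>

lemma one_minus_prod_one_minus:
  fixes f :: "'b \<Rightarrow> 'c :: comm_ring_1"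
  assumes "finite A"
  shows "1 - (\<Prod>i\<in>A. 1 - f i) = (\<Sum>I | I \<subseteq> A \<and> I \<noteq> {}. (-1) ^ (card I + 1) * (\<Prod>i\<in>I. f i))"
proof -
  have "(\<Prod>i\<in>A. 1 - f i) = (\<Sum>I\<in>Pow A. (-1) ^ card I * (\<Prod>i\<in>I. f i))"
    using prod_diff_conv_sum[OF assms, of "\<lambda>_. 1" f] by simp
  also have "\<dots> = 1 + (\<Sum>I\<in>Pow A - {{}}. (-1) ^ card I * (\<Prod>i\<in>I. f i))"
    using assms by (subst sum.remove[of _ "{}"]) auto
  also have "Pow A - {{}} = {I. I \<subseteq> A \<and> I \<noteq> {}}"
    by auto
  finally show ?thesis
    by (simp add: sum_negf)
qed

text \<open>For finite \<open>A\<close> and positive \<open>p\<close>, this is the mean of the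
  maximum of independent exponential variables with rates \<open>p i\<close>.\<close>

definition subset_mean :: "'b set \<Rightarrow> ('b \<Rightarrow> real) \<Rightarrow> real" where
  "subset_mean A p = (\<Sum>I | I \<subseteq> A \<and> I \<noteq> {}. (-1) ^ (card I + 1) / sum p I)"

text \<open>After expansion, each nonempty \<open>I\<close> contributes a multiple of
  \<open>exp (- (sum p I * x))\<close>, whose integral over the half-line is
  \<open>1 / sum p I\<close>.\<close>

lemma nn_integral_one_minus_prod_exp:
  fixes p :: "'b \<Rightarrow> real"
  assumes "finite A" and pos: "\<And>i. i \<in> A \<Longrightarrow> p i > 0"
  shows "(\<integral>\<^sup>+x\<in>{0..}. ennreal (1 - (\<Prod>i\<in>A. 1 - exp (- (p i * x)))) \<partial>lborel)
    = ennreal (subset_mean A p)"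
proof -
  let ?S = "{I. I \<subseteq> A \<and> I \<noteq> {}}"
  let ?F = "\<lambda>x. \<Sum>I\<in>?S. (-1) ^ card I * exp (- (sum p I * x)) / sum p I"
  have S: "finite I" "sum p I > 0" if "I \<in> ?S" for I
    using that pos finite_subset[OF _ \<open>finite A\<close>] by (auto intro!: sum_pos)
  have expand: "1 - (\<Prod>i\<in>A. 1 - exp (- (p i * x))) =
      (\<Sum>I\<in>?S. (-1) ^ (card I + 1) * exp (- (sum p I * x)))" for x
    unfolding one_minus_prod_one_minus[OF \<open>finite A\<close>]
    using S by (intro sum.cong) (simp_all add: exp_sum sum_distrib_right flip: sum_negf)
  \<comment> \<open>The summands alternate in sign, while the fundamental theorem for nonnegative
    integrals asks for a nonnegative integrand. It is therefore applied once, to the whole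
    sum.\<close>
  have "(\<integral>\<^sup>+x\<in>{0..}. ennreal (1 - (\<Prod>i\<in>A. 1 - exp (- (p i * x)))) \<partial>lborel) = ennreal (0 - ?F 0)"
  proof (rule nn_integral_FTC_atLeast)
    show "(\<lambda>x. 1 - (\<Prod>i\<in>A. 1 - exp (- (p i * x)))) \<in> borel_measurable borel"
      by measurable
    show "(?F has_real_derivative 1 - (\<Prod>i\<in>A. 1 - exp (- (p i * x)))) (at x)" for x
      unfolding expand
    proof (rule DERIV_sum)
      fix I assume "I \<in> ?S"
      have "((\<lambda>x. exp (- (sum p I * x))) has_real_derivative exp (- (sum p I * x)) * - (sum p I)) (at x)"
        by (rule derivative_eq_intros refl)+ simp
      then have "((\<lambda>x. (-1) ^ card I * exp (- (sum p I * x)) / sum p I) has_real_derivative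
          (-1) ^ card I * (exp (- (sum p I * x)) * - (sum p I)) / sum p I) (at x)"
        by (intro DERIV_cdivide DERIV_cmult)
      then show "((\<lambda>x. (-1) ^ card I * exp (- (sum p I * x)) / sum p I) has_real_derivative
          (-1) ^ (card I + 1) * exp (- (sum p I * x))) (at x)"
        using S(2)[OF \<open>I \<in> ?S\<close>] by simp
    qed
    show "0 \<le> 1 - (\<Prod>i\<in>A. 1 - exp (- (p i * x)))" if "0 \<le> x" for x
      using that pos by (auto intro!: prod_le_1 simp: less_imp_le)
    have "((\<lambda>x. (-1) ^ card I * exp (- (sum p I * x)) / sum p I) \<longlongrightarrow> (-1) ^ card I * 0 / sum p I) at_top"
      if "I \<in> ?S" for I
    proof -
      have "filterlim (\<lambda>x. - (sum p I * x)) at_bot at_top"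
        unfolding filterlim_uminus_at_bot
        using S(2)[OF that]
        by (auto intro!: filterlim_tendsto_pos_mult_at_top[OF tendsto_const] filterlim_ident)
      then have "((\<lambda>x. exp (- (sum p I * x))) \<longlongrightarrow> 0) at_top"
        by (rule filterlim_compose[OF exp_at_bot])
      then show ?thesis
        using S(2)[OF that] by (intro tendsto_intros) auto
    qed
    then have "(?F \<longlongrightarrow> (\<Sum>I\<in>?S. (-1) ^ card I * 0 / sum p I)) at_top"
      by (rule tendsto_sum)
    then show "(?F \<longlongrightarrow> 0) at_top"
      by simp
  qed
  also have "0 - ?F 0 = subset_mean A p"
    by (simp add: subset_mean_def sum_negf)
  finally show ?thesis .
qed

text \<open>With \<open>q = 1 - e\<^bsup>-x/m\<^esup>\<close>, the integrand is \<open>1 - q\<^sup>m = (1 - q) (1 + q + \<dots> + q\<^bsup>m-1\<^esup>)\<close>, and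
  \<open>1 - q\<close> is \<open>m\<close> times the derivative of \<open>q\<close>.\<close>

lemma nn_integral_uniform:
  assumes "m \<ge> 1"
  shows "(\<integral>\<^sup>+x\<in>{0..}. ennreal (1 - (1 - exp (- (1 / real m * x))) ^ m) \<partial>lborel)
    = ennreal (real m * (\<Sum>i=1..m. 1 / real i))"
proof -
  let ?q = "\<lambda>x. 1 - exp (- (1 / real m * x))"
  \<comment> \<open>Antiderivative obtained by integrating each power of \<open>q\<close>. As
    \<open>x\<close> runs from 0 to infinity, \<open>q\<close> runs from 0 to 1, which leaves
    \<open>m\<close> times the harmonic sum.\<close>
  let ?F = "\<lambda>x. real m * (\<Sum>j<m. ?q x ^ Suc j / real (Suc j))"
  have "(\<integral>\<^sup>+x\<in>{0..}. ennreal (1 - ?q x ^ m) \<partial>lborel)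
      = ennreal (real m * (\<Sum>j<m. 1 ^ Suc j / real (Suc j)) - ?F 0)"
  proof (rule nn_integral_FTC_atLeast)
    show "(\<lambda>x. 1 - ?q x ^ m) \<in> borel_measurable borel"
      by measurable
    fix x :: real
    have q: "(?q has_real_derivative (1 - ?q x) / real m) (at x)"
      by (rule derivative_eq_intros refl)+ simp
    have "((\<lambda>x. ?q x ^ Suc j / real (Suc j)) has_real_derivative (1 - ?q x) * ?q x ^ j / real m) (at x)" for j
      using DERIV_cdivide[OF DERIV_power[OF q, of "Suc j"], of "real (Suc j)"]
      by (simp del: of_nat_Suc power_Suc add: mult_ac)
    then have "(?F has_real_derivative real m * (\<Sum>j<m. (1 - ?q x) * ?q x ^ j / real m)) (at x)"
      by (intro DERIV_cmult DERIV_sum)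
    also have "real m * (\<Sum>j<m. (1 - ?q x) * ?q x ^ j / real m) = 1 - ?q x ^ m"
      unfolding one_diff_power_eq using \<open>m \<ge> 1\<close> by (simp add: sum_distrib_left)
    finally show "(?F has_real_derivative 1 - ?q x ^ m) (at x)" .
    show "0 \<le> 1 - ?q x ^ m" if "0 \<le> x"
      using that by (simp add: power_le_one)
  next
    have "filterlim (\<lambda>x. - (1 / real m * x)) at_bot at_top"
      unfolding filterlim_uminus_at_bot using \<open>m \<ge> 1\<close>
      by (auto intro!: filterlim_tendsto_pos_mult_at_top[OF tendsto_const] filterlim_ident
          simp del: times_divide_eq_left)
    then have "((\<lambda>x. exp (- (1 / real m * x))) \<longlongrightarrow> 0) at_top"
      by (rule filterlim_compose[OF exp_at_bot])
    then have "(?q \<longlongrightarrow> 1 - 0) at_top"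
      by (intro tendsto_diff tendsto_const)
    then have "(?q \<longlongrightarrow> 1) at_top"
      by simp
    then show "(?F \<longlongrightarrow> real m * (\<Sum>j<m. 1 ^ Suc j / real (Suc j))) at_top"
      by (intro tendsto_intros) auto
  qed
  also have "real m * (\<Sum>j<m. 1 ^ Suc j / real (Suc j)) - ?F 0 = real m * (\<Sum>i=1..m. 1 / real i)"
    by (simp add: sum.atLeast1_atMost_eq)
  finally show ?thesis .
qed

section \<open>Probability that a block of draws misses a label\<close>

locale coupon_collector = prob_space M for M :: "'a measure" +
  fixes A :: "'b set" and p :: "'b \<Rightarrow> real" and Y :: "nat \<Rightarrow> 'a \<Rightarrow> 'b"
  assumes finite_labels: "finite A"
    and pos: "\<And>i. i \<in> A \<Longrightarrow> p i > 0"
    and indep: "indep_vars (\<lambda>_. count_space UNIV) Y {1..}"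
    and law: "\<And>i j. i \<in> A \<Longrightarrow> j \<ge> 1 \<Longrightarrow> prob {\<omega> \<in> space M. Y j \<omega> = i} = p i"
begin

lemma Y_measurable: "j \<ge> 1 \<Longrightarrow> Y j \<in> M \<rightarrow>\<^sub>M count_space UNIV"
  using indep unfolding indep_vars_def2 by auto

lemma sets_collected [measurable]: "{\<omega> \<in> space M. A \<subseteq> (\<lambda>j. Y j \<omega>) ` {a<..b}} \<in> sets M"
proof -
  have [measurable]: "Measurable.pred M (\<lambda>\<omega>. Y j \<omega> = i)" if "j \<in> {a<..b}" for i j
    using measurable_compose[OF Y_measurable, of j "\<lambda>y. y = i" "count_space UNIV"] that by simp
  have "{\<omega> \<in> space M. A \<subseteq> (\<lambda>j. Y j \<omega>) ` {a<..b}} = {\<omega> \<in> space M. \<forall>i\<in>A. \<exists>j\<in>{a<..b}. Y j \<omega> = i}"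
    by force
  also have "\<dots> \<in> sets M"
    using finite_labels by measurable
  finally show ?thesis .
qed

lemma pred_collected [measurable]: "Measurable.pred M (\<lambda>\<omega>. A \<subseteq> (\<lambda>j. Y j \<omega>) ` {a<..b})"
  using sets_collected by (simp add: pred_def)

text \<open>Collection as an event on the product space of coordinates in \<open>J\<close>, where
  independence of two disjoint families of draws is expressed.\<close>

lemma pred_PiM_collected:
  fixes a b :: nat
  assumes "{a<..b} \<subseteq> J"
  shows "Measurable.pred (PiM J (\<lambda>_. count_space (UNIV :: 'b set))) (\<lambda>f. A \<subseteq> f ` {a<..b})"
proof -
  have [measurable]: "Measurable.pred (PiM J (\<lambda>_. count_space (UNIV :: 'b set))) (\<lambda>f. f j = i)"
    if "j \<in> {a<..b}" for i j
    using measurable_compose[OF measurable_component_singleton[of j J "\<lambda>_. count_space UNIV"],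
        of "\<lambda>y. y = i" "count_space UNIV"]
      that assms by auto
  have "(\<lambda>f. A \<subseteq> f ` {a<..b}) = (\<lambda>f. \<forall>i\<in>A. \<exists>j\<in>{a<..b}. f j = i)"
    by (force simp: fun_eq_iff)
  also have "Measurable.pred (PiM J (\<lambda>_. count_space UNIV)) \<dots>"
    using finite_labels by measurable
  finally show ?thesis .
qed

lemma prob_notin:
  assumes "I \<subseteq> A" "j \<ge> 1"
  shows "prob {\<omega> \<in> space M. Y j \<omega> \<notin> I} = 1 - sum p I"
proof -
  note [measurable] = Y_measurable[OF \<open>j \<ge> 1\<close>]
  have "prob {\<omega> \<in> space M. Y j \<omega> \<in> I} = prob (\<Union>i\<in>I. {\<omega> \<in> space M. Y j \<omega> = i})"
    by (intro arg_cong[where f = prob]) auto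
  also have "\<dots> = (\<Sum>i\<in>I. prob {\<omega> \<in> space M. Y j \<omega> = i})"
  proof (rule finite_measure_finite_Union)
    show "finite I"
      using assms finite_labels finite_subset by blast
    show "(\<lambda>i. {\<omega> \<in> space M. Y j \<omega> = i}) ` I \<subseteq> events"
      by auto
  qed (auto simp: disjoint_family_on_def)
  also have "\<dots> = sum p I"
    using assms law by (intro sum.cong) auto
  finally have "prob {\<omega> \<in> space M. Y j \<omega> \<in> I} = sum p I" .
  moreover have "{\<omega> \<in> space M. Y j \<omega> \<in> I} \<in> events"
    by (rule measurable_sets_Collect[OF Y_measurable[OF \<open>j \<ge> 1\<close>]]) simp
  ultimately show ?thesis
    by (simp add: prob_neg)
qed

text \<open>The complement \<open>1 - sum p I\<close> is a probability. Later it is the ratio of a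
  geometric series.\<close>

lemma sum_p_le_1: "I \<subseteq> A \<Longrightarrow> sum p I \<le> 1"
  using prob_notin[of I 1] measure_nonneg[of M "{\<omega> \<in> space M. Y 1 \<omega> \<notin> I}"] by simp

lemma prob_block_notin:
  assumes "I \<subseteq> A"
  shows "prob {\<omega> \<in> space M. \<forall>j\<in>{a<..b}. Y j \<omega> \<notin> I} = (1 - sum p I) ^ (b - a)"
\<comment> \<open>The product rule for independent variables concerns nonempty index sets. For an
  empty block the truncated difference \<open>b - a\<close> is 0 and both sides are 1.\<close>
proof (cases "a < b")
  case True
  have "prob {\<omega> \<in> space M. \<forall>j\<in>{a<..b}. Y j \<omega> \<notin> I} = prob (\<Inter>j\<in>{a<..b}. Y j -` (- I) \<inter> space M)"
    using True by (intro arg_cong[where f = prob]) auto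
  also have "\<dots> = (\<Prod>j\<in>{a<..b}. prob (Y j -` (- I) \<inter> space M))"
    using True by (intro indep_varsD[OF indep]) auto
  also have "\<dots> = (\<Prod>j\<in>{a<..b}. 1 - sum p I)"
  proof (rule prod.cong)
    fix j assume "j \<in> {a<..b}"
    moreover have "Y j -` (- I) \<inter> space M = {\<omega> \<in> space M. Y j \<omega> \<notin> I}"
      by auto
    ultimately show "prob (Y j -` (- I) \<inter> space M) = 1 - sum p I"
      using prob_notin[OF assms] by simp
  qed simp
  finally show ?thesis
    by simp
qed (simp add: prob_space)

text \<open>Given by its inclusion-exclusion formula, so that it visibly depends on the block length
  alone. Its meaning as a probability is \<open>prob_not_collected\<close>.\<close>

definition not_collected_prob :: "nat \<Rightarrow> real" where
  "not_collected_prob n = (\<Sum>I | I \<subseteq> A \<and> I \<noteq> {}. (-1) ^ (card I + 1) * (1 - sum p I) ^ n)"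

text \<open>Inclusion-exclusion over the events that a given label is missed. The intersection over
  \<open>I\<close> says that every draw of the block avoids \<open>I\<close>.\<close>

lemma prob_not_collected:
  "prob {\<omega> \<in> space M. \<not> A \<subseteq> (\<lambda>j. Y j \<omega>) ` {a<..b}} = not_collected_prob (b - a)"
proof -
  interpret Incl_Excl "\<lambda>S. S \<in> events" prob
    by standard (auto simp: finite_measure_Union disjnt_def)
  let ?miss = "\<lambda>i. {\<omega> \<in> space M. \<forall>j\<in>{a<..b}. Y j \<omega> \<noteq> i}"
  have sets: "?miss i \<in> events" for i
  proof -
    have [measurable]: "Measurable.pred M (\<lambda>\<omega>. Y j \<omega> = i)" if "j \<in> {a<..b}" for j
      using measurable_compose[OF Y_measurable, of j "\<lambda>y. y = i" "count_space UNIV"] that by simp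
    show ?thesis
      by measurable
  qed
  have "{\<omega> \<in> space M. \<not> A \<subseteq> (\<lambda>j. Y j \<omega>) ` {a<..b}} = \<Union> (?miss ` A)"
    by force
  also have "prob \<dots> = (\<Sum>I | I \<subseteq> A \<and> I \<noteq> {}. (-1) ^ (card I + 1) * prob (\<Inter> (?miss ` I)))"
    using finite_labels sets by (rule restricted_indexed)
  also have "\<dots> = not_collected_prob (b - a)"
    unfolding not_collected_prob_def
  proof (rule sum.cong)
    fix I assume I: "I \<in> {I. I \<subseteq> A \<and> I \<noteq> {}}"
    then have "\<Inter> (?miss ` I) = {\<omega> \<in> space M. \<forall>j\<in>{a<..b}. Y j \<omega> \<notin> I}"
      by auto
    with I show "(-1) ^ (card I + 1) * prob (\<Inter> (?miss ` I)) = (-1) ^ (card I + 1) * (1 - sum p I) ^ (b - a)"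
      by (simp add: prob_block_notin)
  qed simp
  finally show ?thesis .
qed

lemma not_collected_prob_nonneg: "not_collected_prob n \<ge> 0"
  using prob_not_collected[of 0 n] by (metis diff_zero measure_nonneg)

text \<open>Summing the tails of the collection time gives its mean. Each \<open>I\<close> yields a
  geometric series with ratio \<open>1 - sum p I\<close>, which lies in
  \<open>[0, 1)\<close>.\<close>

lemma sums_not_collected_prob: "not_collected_prob sums subset_mean A p"
  unfolding not_collected_prob_def subset_mean_def
proof (rule sums_sum)
  fix I assume I: "I \<in> {I. I \<subseteq> A \<and> I \<noteq> {}}"
  then have "sum p I > 0"
    using pos finite_subset[OF _ finite_labels] by (auto intro!: sum_pos)
  moreover have "sum p I \<le> 1"
    using I sum_p_le_1 by auto
  ultimately have "(\<lambda>n. (1 - sum p I) ^ n) sums (1 / (1 - (1 - sum p I)))"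
    by (intro geometric_sums) auto
  then show "(\<lambda>n. (-1) ^ (card I + 1) * (1 - sum p I) ^ n) sums ((-1) ^ (card I + 1) / sum p I)"
    using sums_mult[of _ _ "(-1) ^ (card I + 1)"] by fastforce
qed

section \<open>The first collection time and the draws after it\<close>

text \<open>A predicate on sequences rather than on sample points, so that it also applies to points
  of the product space over \<open>{0<..k}\<close>.\<close>

definition first_collected :: "nat \<Rightarrow> (nat \<Rightarrow> 'b) \<Rightarrow> bool" where
  "first_collected k y \<longleftrightarrow> A \<subseteq> y ` {0<..k} \<and> (\<forall>l<k. \<not> A \<subseteq> y ` {0<..l})"

lemma pred_first_collected [measurable]: "Measurable.pred M (\<lambda>\<omega>. first_collected k (\<lambda>j. Y j \<omega>))"
  unfolding first_collected_def by measurable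

text \<open>The labels collected after time \<open>k\<close> are independent of the event that \<open>k\<close> is the first
  collection time: this replaces the strong Markov property.\<close>

lemma prob_first_collected_and_not_collected:
  assumes "k \<le> n"
  shows "prob {\<omega> \<in> space M. first_collected k (\<lambda>j. Y j \<omega>) \<and> \<not> A \<subseteq> (\<lambda>j. Y j \<omega>) ` {k<..n}}
    = prob {\<omega> \<in> space M. first_collected k (\<lambda>j. Y j \<omega>)} * not_collected_prob (n - k)"
proof -
  let ?N = "\<lambda>J. PiM J (\<lambda>_::nat. count_space (UNIV :: 'b set))"
  let ?J = "{0<..k}" and ?K = "{k<..n}"
  define U where "U = {f \<in> space (?N ?J). first_collected k f}"
  define V where "V = {f \<in> space (?N ?K). \<not> A \<subseteq> f ` ?K}"
  let ?Y = "\<lambda>J \<omega>. restrict (\<lambda>j. Y j \<omega>) J"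
  have "indep_var (?N ?J) (?Y ?J) (?N ?K) (?Y ?K)"
    by (rule indep_var_restrict[OF indep]) auto
  moreover have "U \<in> sets (?N ?J)"
  proof -
    have [measurable]: "Measurable.pred (?N ?J) (\<lambda>f. A \<subseteq> f ` {0<..l})" if "l \<le> k" for l
      using that by (intro pred_PiM_collected) auto
    have "U = {f \<in> space (?N ?J). A \<subseteq> f ` {0<..k} \<and> (\<forall>l\<in>{..<k}. \<not> A \<subseteq> f ` {0<..l})}"
      by (auto simp: U_def first_collected_def)
    also have "\<dots> \<in> sets (?N ?J)"
      by measurable
    finally show ?thesis .
  qed
  moreover have "V \<in> sets (?N ?K)"
    using pred_PiM_collected[of k n ?K] unfolding V_def by measurable
  ultimately have *: "prob ((\<lambda>\<omega>. (?Y ?J \<omega>, ?Y ?K \<omega>)) -` (U \<times> V) \<inter> space M)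
      = prob (?Y ?J -` U \<inter> space M) * prob (?Y ?K -` V \<inter> space M)"
    by (rule indep_varD)
  \<comment> \<open>Both the collection by time \<open>k\<close> and the minimality of
    \<open>k\<close> inspect only blocks \<open>{0<..l}\<close> with \<open>l \<le> k\<close>, so
    restricting to \<open>{0<..k}\<close> loses nothing.\<close>
  have "first_collected k (?Y ?J \<omega>) \<longleftrightarrow> first_collected k (\<lambda>j. Y j \<omega>)" for \<omega>
  proof -
    have "?Y ?J \<omega> ` {0<..l} = (\<lambda>j. Y j \<omega>) ` {0<..l}" if "l \<le> k" for l
      using that by (intro image_cong) auto
    then show ?thesis
      by (simp add: first_collected_def)
  qed
  then have in_U: "?Y ?J \<omega> \<in> U \<longleftrightarrow> first_collected k (\<lambda>j. Y j \<omega>)" for \<omega>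
    by (auto simp: U_def space_PiM)
  have in_V: "?Y ?K \<omega> \<in> V \<longleftrightarrow> \<not> A \<subseteq> (\<lambda>j. Y j \<omega>) ` ?K" for \<omega>
    by (auto simp: V_def space_PiM)
  have "(\<lambda>\<omega>. (?Y ?J \<omega>, ?Y ?K \<omega>)) -` (U \<times> V) \<inter> space M
      = {\<omega> \<in> space M. first_collected k (\<lambda>j. Y j \<omega>) \<and> \<not> A \<subseteq> (\<lambda>j. Y j \<omega>) ` ?K}"
    "?Y ?J -` U \<inter> space M = {\<omega> \<in> space M. first_collected k (\<lambda>j. Y j \<omega>)}"
    "?Y ?K -` V \<inter> space M = {\<omega> \<in> space M. \<not> A \<subseteq> (\<lambda>j. Y j \<omega>) ` ?K}"
    by (auto simp only: vimage_eq Int_iff mem_Times_iff fst_conv snd_conv mem_Collect_eq in_U in_V)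
  with * show ?thesis
    by (simp add: prob_not_collected)
qed

text \<open>A sequence has at most one first collection time, so these events are disjoint and their
  probabilities add up to that of their union.\<close>

lemma first_collected_probs:
  "summable (\<lambda>k. prob {\<omega> \<in> space M. first_collected k (\<lambda>j. Y j \<omega>)})"
  "(\<Sum>k. prob {\<omega> \<in> space M. first_collected k (\<lambda>j. Y j \<omega>)}) \<le> 1"
proof -
  let ?E = "\<lambda>k. {\<omega> \<in> space M. first_collected k (\<lambda>j. Y j \<omega>)}"
  have "(\<lambda>k. prob (?E k)) sums prob (\<Union>k. ?E k)"
  proof (rule finite_measure_UNION)
    show "disjoint_family ?E"
      unfolding disjoint_family_on_def first_collected_def using nat_neq_iff by blast
  qed auto
  then show "summable (\<lambda>k. prob (?E k))" "(\<Sum>k. prob (?E k)) \<le> 1"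
    by (auto simp: sums_iff)
qed

section \<open>Collecting all labels twice in succession\<close>

definition not_twice_collected :: "nat \<Rightarrow> 'a set" where
  "not_twice_collected n = {\<omega> \<in> space M. \<forall>k.
     \<not> (A \<subseteq> (\<lambda>j. Y j \<omega>) ` {0<..k} \<and> A \<subseteq> (\<lambda>j. Y j \<omega>) ` {k<..n})}"

lemma not_twice_collected_sets [measurable]: "not_twice_collected n \<in> events"
  unfolding not_twice_collected_def by measurable

text \<open>Either the labels are not all collected by time \<open>n\<close>, or the first
  collection time is some \<open>k \<le> n\<close> and the block \<open>{k<..n}\<close> misses a
  label. The union bound and independence give the convolution.\<close>

lemma prob_not_twice_collected_le:
  "prob (not_twice_collected n) \<le> not_collected_prob n +
     (\<Sum>k\<le>n. prob {\<omega> \<in> space M. first_collected k (\<lambda>j. Y j \<omega>)} * not_collected_prob (n - k))"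
proof -
  let ?C = "{\<omega> \<in> space M. \<not> A \<subseteq> (\<lambda>j. Y j \<omega>) ` {0<..n}}"
  let ?D = "\<lambda>k. {\<omega> \<in> space M. first_collected k (\<lambda>j. Y j \<omega>) \<and> \<not> A \<subseteq> (\<lambda>j. Y j \<omega>) ` {k<..n}}"
  have "not_twice_collected n \<subseteq> ?C \<union> (\<Union>k\<le>n. ?D k)"
  proof
    fix \<omega> assume \<omega>: "\<omega> \<in> not_twice_collected n"
    show "\<omega> \<in> ?C \<union> (\<Union>k\<le>n. ?D k)"
    proof (cases "A \<subseteq> (\<lambda>j. Y j \<omega>) ` {0<..n}")
      case True
      define k where "k = (LEAST k. A \<subseteq> (\<lambda>j. Y j \<omega>) ` {0<..k})"
      have "k \<le> n" "first_collected k (\<lambda>j. Y j \<omega>)"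
        using True LeastI[of "\<lambda>k. A \<subseteq> (\<lambda>j. Y j \<omega>) ` {0<..k}", OF True]
        by (auto simp: k_def first_collected_def intro: Least_le dest: not_less_Least)
      then show ?thesis
        using \<omega> by (auto simp: not_twice_collected_def first_collected_def)
    qed (use \<omega> in \<open>auto simp: not_twice_collected_def\<close>)
  qed
  then have "prob (not_twice_collected n) \<le> prob (?C \<union> (\<Union>k\<le>n. ?D k))"
    by (intro finite_measure_mono) auto
  also have "\<dots> \<le> prob ?C + prob (\<Union>k\<le>n. ?D k)"
    by (intro measure_Un_le) auto
  also have "prob (\<Union>k\<le>n. ?D k) \<le> (\<Sum>k\<le>n. prob (?D k))"
    by (intro finite_measure_subadditive_finite) auto
  finally show ?thesis
    by (simp add: prob_not_collected prob_first_collected_and_not_collected)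
qed

text \<open>In the summed bound, the first term gives one mean. The convolution gives the mean times
  the total mass of the first collection time, which is at most 1.\<close>

lemma nn_integral_suminf_not_twice_collected_le:
  "(\<integral>\<^sup>+\<omega>. (\<Sum>n. indicator (not_twice_collected n) \<omega>) \<partial>M) \<le> ennreal (2 * subset_mean A p)"
proof -
  let ?t = "\<lambda>k. prob {\<omega> \<in> space M. first_collected k (\<lambda>j. Y j \<omega>)}"
  let ?u = not_collected_prob
  let ?mean = "subset_mean A p"
  have mean: "summable ?u" "suminf ?u = ?mean" "?mean \<ge> 0"
    using sums_not_collected_prob not_collected_prob_nonneg sums_le[OF _ sums_zero, of ?u ?mean]
    by (auto simp: sums_iff)
  \<comment> \<open>Cauchy product; the absolute convergence it requires is plain convergence here,
    as both sequences are nonnegative.\<close>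
  have "(\<lambda>n. \<Sum>k\<le>n. ?t k * ?u (n - k)) sums (suminf ?t * suminf ?u)"
    using first_collected_probs(1) mean(1) not_collected_prob_nonneg
    by (intro Cauchy_product_sums) simp_all
  then have "(\<lambda>n. ?u n + (\<Sum>k\<le>n. ?t k * ?u (n - k))) sums (?mean + suminf ?t * ?mean)"
    using sums_not_collected_prob mean(2) by (intro sums_add) auto
  then have "(\<Sum>n. ennreal (?u n + (\<Sum>k\<le>n. ?t k * ?u (n - k)))) = ennreal (?mean + suminf ?t * ?mean)"
    using not_collected_prob_nonneg by (intro suminf_ennreal_eq add_nonneg_nonneg sum_nonneg) auto
  moreover have "(\<integral>\<^sup>+\<omega>. (\<Sum>n. indicator (not_twice_collected n) \<omega>) \<partial>M)
      = (\<Sum>n. emeasure M (not_twice_collected n))"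
    by (simp add: nn_integral_suminf)
  moreover have "(\<Sum>n. emeasure M (not_twice_collected n))
      \<le> (\<Sum>n. ennreal (?u n + (\<Sum>k\<le>n. ?t k * ?u (n - k))))"
    unfolding emeasure_eq_measure
    by (intro suminf_le ennreal_leI prob_not_twice_collected_le) auto
  moreover have "?mean + suminf ?t * ?mean \<le> 2 * ?mean"
    using mult_right_mono[OF first_collected_probs(2) mean(3)] by simp
  ultimately show ?thesis
    by (metis (no_types, lifting) ennreal_leI order_trans)
qed

end

section \<open>The bounds on the expected waiting time\<close>

theorem theorem13:
  fixes m :: nat and p :: "nat \<Rightarrow> real" and M :: "'a measure" and Y :: "nat \<Rightarrow> 'a \<Rightarrow> nat"
  assumes "m \<ge> 1"
    and "\<And>i. i \<in> {1..m} \<Longrightarrow> p i > 0"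
    and "(\<Sum>i=1..m. p i) = 1"
    and "prob_space M"
    and "prob_space.indep_vars M (\<lambda>_. count_space UNIV) Y {1..}"
    and "\<And>i j. i \<in> {1..m} \<Longrightarrow> j \<ge> 1 \<Longrightarrow> measure M {\<omega> \<in> space M. Y j \<omega> = i} = p i"
  shows "(\<integral>\<^sup>+\<omega>. ennreal_of_enat (nerve_waiting_time m (\<lambda>j. Y j \<omega>)) \<partial>M)
           \<le> 2 * (\<integral>\<^sup>+x\<in>{0..}. ennreal (1 - (\<Prod>i=1..m. 1 - exp (- (p i * x)))) \<partial>lborel)
    \<and> ((\<forall>i\<in>{1..m}. p i = 1 / real m) \<longrightarrow>
         (\<integral>\<^sup>+\<omega>. ennreal_of_enat (nerve_waiting_time m (\<lambda>j. Y j \<omega>)) \<partial>M)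
           \<le> ennreal (2 * real m * (\<Sum>i=1..m. 1 / real i)))"
    (is "?EX \<le> 2 * ?int \<and> _")
proof -
  interpret prob_space M
    by fact
  interpret coupon_collector M "{1..m}" p Y
    by unfold_locales (fact finite_atLeastAtMost assms)+
  have "?EX \<le> (\<integral>\<^sup>+\<omega>. (\<Sum>n. indicator (not_twice_collected n) \<omega>) \<partial>M)"
  proof (intro nn_integral_mono ennreal_of_enat_le_suminf)
    fix \<omega> n
    assume "\<omega> \<in> space M" "enat n < nerve_waiting_time m (\<lambda>j. Y j \<omega>)"
    \<comment> \<open>Contrapositive of \<open>nerve_waiting_time_le\<close>: a split point
      \<open>k\<close> with both blocks complete would force the waiting time to be at most
      \<open>n\<close>.\<close>
    then have "\<omega> \<in> not_twice_collected n"
      using nerve_waiting_time_le[OF \<open>m \<ge> 1\<close>, of "\<lambda>j. Y j \<omega>"] leD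
      unfolding not_twice_collected_def by blast
    then show "1 \<le> (indicator (not_twice_collected n) \<omega> :: ennreal)"
      by simp
  qed
  also have "\<dots> \<le> ennreal (2 * subset_mean {1..m} p)"
    by (rule nn_integral_suminf_not_twice_collected_le)
  also have "\<dots> = 2 * ?int"
    by (subst nn_integral_one_minus_prod_exp[OF finite_labels pos], assumption)
      (simp only: ennreal_mult' ennreal_numeral zero_le_numeral)
  finally have "?EX \<le> 2 * ?int" .
  \<comment> \<open>With equal probabilities the product becomes an \<open>m\<close>-th power, and
    the uniform integral evaluates the general bound exactly.\<close>
  moreover have "2 * ?int = ennreal (2 * real m * (\<Sum>i=1..m. 1 / real i))"
    if "\<forall>i\<in>{1..m}. p i = 1 / real m"
  proof -
    have "(\<Prod>i=1..m. 1 - exp (- (p i * x))) = (\<Prod>i=1..m. 1 - exp (- (1 / real m * x)))" for x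
      using that by (intro prod.cong) simp_all
    then have "(\<Prod>i=1..m. 1 - exp (- (p i * x))) = (1 - exp (- (1 / real m * x))) ^ m" for x
      by simp
    then have "?int = ennreal (real m * (\<Sum>i=1..m. 1 / real i))"
      using nn_integral_uniform[OF \<open>m \<ge> 1\<close>] by (simp only:)
    then show ?thesis
      unfolding mult.assoc by (simp only: ennreal_mult' ennreal_numeral zero_le_numeral)
  qed
  ultimately show ?thesis
    by (auto simp only:)
qed

end
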